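(* Let $f:\mathbb{R}^n\to\mathbb{R}$ be a differentiable loss, let $\mathbf{x}_1\in\mathbb{R}^n$ be any initial point and let $T\ge 1$. Let $\mathbf{x}_1,\mathbf{x}_2,\ldots,\mathbf{x}_{T+1}$ be the iterates produced either by the algorithm SafeRate or by the algorithm SafeCombination (both defined in the context), with any choice of direction oracle and any upper-bound function meeting the stated specification. Then $$f(\mathbf{x}_{T+1})\le f(\mathbf{x}_T)\le\cdots\le f(\mathbf{x}_1).$$
   Context: Vector inequalities are elementwise; for $\mathbf{a}\le\mathbf{b}$ in $\mathbb{R}^d$, $[\mathbf{a},\mathbf{b}]=\{\mathbf{z}\in\mathbb{R}^d:\mathbf{a}\le\mathbf{z}\le\mathbf{b}\}$. **SafeRate.** Parameters: (1) a function $\mathcal{O}$ (direction oracle) that, given the current iterate $\mathbf{x}_t$ and the observed gradients $\mathbf{g}_1,\ldots,\mathbf{g}_t$, returns an update direction in $\mathbb{R}^n$; (2) a function PolynomialUpperBound that, given $h:\mathbb{R}\to\mathbb{R}$, an interval $[a,b]$ and $z_0\in[a,b]$, returns a polynomial $P$ of degree $k$ (a fixed integer) such that $h(z)\le P(z)$ for all $z\in[a,b]$ and $P(z_0)=h(z_0)$. Initialize $\bar\eta_1=1$. For $t=1,\ldots,T$: - $\mathbf{g}_t=\nabla f(\mathbf{x}_t)$ and $\mathbf{v}_t=\mathcal{O}(\mathbf{x}_t,\{\mathbf{g}_s\}_{s=1}^t)$; - $h_t(\eta)=f(\mathbf{x}_t+\eta\mathbf{v}_t)$ and $P_t=\mathrm{PolynomialUpperBound}(h_t,[0,\bar\eta_t],0)$;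 - $\eta_t\in\mathrm{argmin}_{\eta\in[0,\bar\eta_t]}P_t(\eta)$; - $\mathbf{x}_{t+1}=\mathbf{x}_t+\eta_t\mathbf{v}_t$; - $\bar\eta_{t+1}=2\bar\eta_t$ if $\eta_t\ge\frac12\bar\eta_t$, and $\bar\eta_{t+1}=\frac12\bar\eta_t$ otherwise. **SafeCombination.** Parameters: (1) a function $\mathcal{O}$ that, given $\mathbf{x}_t$ and $\mathbf{g}_1,\ldots,\mathbf{g}_t$, returns an $n\times d$ matrix whose columns are update directions; (2) a function PolynomialUpperBound that, given $h:\mathbb{R}^d\to\mathbb{R}$, a vector interval $[\mathbf{a},\mathbf{b}]\subseteq\mathbb{R}^d$ and $\mathbf{z}_0\in[\mathbf{a},\mathbf{b}]$, returns a quadratic polynomial $P$ with $h(\mathbf{z})\le P(\mathbf{z})$ for all $\mathbf{z}\in[\mathbf{a},\mathbf{b}]$ and $P(\mathbf{z}_0)=h(\mathbf{z}_0)$. Initialize $\bar{\boldsymbol\eta}_1=(1,\ldots,1)\in\mathbb{R}^d$. For $t=1,\ldots,T$: - $\mathbf{g}_t=\nabla f(\mathbf{x}_t)$ and $\mathbf{U}_t=\mathcal{O}(\mathbf{x}_t,\{\mathbf{g}_s\}_{s=1}^t)$; - $h_t(\boldsymbol\eta)=f(\mathbf{x}_t+\mathbf{U}_t\boldsymbol\eta)$ and $P_t=\mathrm{PolynomialUpperBound}(h_t,[\mathbf{0},\bar{\boldsymbol\eta}_t],\mathbf{0})$; - $\boldsymbol\eta_t=\mathrm{MinimizeQuadratic}(P_t,[\mathbf{0},\bar{\boldsymbol\eta}_t])$;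 - $\mathbf{x}_{t+1}=\mathbf{x}_t+\mathbf{U}_t\boldsymbol\eta_t$; - for each $i\in\{1,\ldots,d\}$, $(\bar{\boldsymbol\eta}_{t+1})_i=2(\bar{\boldsymbol\eta}_t)_i$ if $(\boldsymbol\eta_t)_i\ge\frac12(\bar{\boldsymbol\eta}_t)_i$, and $(\bar{\boldsymbol\eta}_{t+1})_i=\frac12(\bar{\boldsymbol\eta}_t)_i$ otherwise. **MinimizeQuadratic.** Given a (possibly non-convex) quadratic polynomial $P$ on $\mathbb{R}^d$ and a box $B=[\mathbf{0},\bar{\boldsymbol\eta}]$, write $P(\mathbf{y})=P(\mathbf{0})+q(\mathbf{y})$ with $q(\mathbf{y})=\frac12\mathbf{y}^{\mathsf T}\mathbf{A}\mathbf{y}-\mathbf{b}^{\mathsf T}\mathbf{y}$, where $\mathbf{A}\in\mathbb{R}^{d\times d}$ is symmetric and $\mathbf{b}\in\mathbb{R}^d$. The procedure has two stages. Stage 1 (a variant of conjugate gradient descent with steps constrained to the box). Set $\mathbf{y}_0=\mathbf{0}$ and $\mathbf{r}_i=\nabla q(\mathbf{y}_i)=\mathbf{A}\mathbf{y}_i-\mathbf{b}$ for each $i$. For $i=1,\ldots,d$, stopping early with the current point if $\mathbf{r}_{i-1}=\mathbf{0}$: - $\mathbf{p}_1=-\mathbf{r}_0$, and for $i\ge2$, $\mathbf{p}_i=-\mathbf{r}_{i-1}+\dfrac{\mathbf{r}_{i-1}^{\mathsf T}\mathbf{r}_{i-1}}{\mathbf{r}_{i-2}^{\mathsf T}\mathbf{r}_{i-2}}\,\mathbf{p}_{i-1}$;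 - $\alpha_i\in\mathrm{argmin}\{q(\alpha\mathbf{p}_i):\alpha\in\mathbb{R},\ \mathbf{y}_{i-1}+\alpha\mathbf{p}_i\in B\}$; - $\mathbf{y}_i=\mathbf{y}_{i-1}+\alpha_i\mathbf{p}_i$. Stage 2 (a single pass of cyclic coordinate descent). Starting from the last point of Stage 1, for $j=1,\ldots,d$ in turn, replace the $j$th coordinate by a value minimizing $q$ over all values keeping the point in $B$, the other coordinates being held fixed. The resulting point is the output of MinimizeQuadratic.
   Formalization: In Stage 1 of MinimizeQuadratic, α_i minimizes q(y_{i-1}+αp_i) instead of q(αp_i) over feasible α; with the literal rule the claim fails for SafeCombination, e.g. f=q with A=[[7,-9],[-9,5]], b=(-1,-1), x_1=0 and U_1 the identity gives f(x_2)=3/20>0=f(x_1). *)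

theory Defs
  imports "HOL-Analysis.Analysis"
begin

text \<open>
  Vector inequalities and intervals are those of the componentwise order on \<^typ>\<open>real ^ 'd\<close>,
  so \<open>{a..b}\<close> is a box. The minimizers below need not be unique; the algorithms are
  therefore relations that hold of every admissible output or sequence of iterates.

  An upper-bound function is a total HOL function, but only its answers to the queries that are
  actually made are constrained. Demanding a valid bound for every function \<open>h\<close> would be
  unsatisfiable, since an \<open>h\<close> that is unbounded on the interval has none.
\<close>

definition poly_upper_bound ::
    "nat \<Rightarrow> (real \<Rightarrow> real) \<Rightarrow> real \<Rightarrow> real \<Rightarrow> real \<Rightarrow> real poly \<Rightarrow> bool" where
  "poly_upper_bound k h a b z0 P \<longleftrightarrow>
     degree P \<le> k \<and> (\<forall>z\<in>{a..b}. h z \<le> poly P z) \<and> poly P z0 = h z0"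

text \<open>
  In \<open>safe_rate f Orc PUB k T x\<close>, the iterates are \<open>x 1, \<dots>, x (T + 1)\<close>, and the
  direction oracle \<open>Orc\<close> receives the current iterate and the list of the gradients observed
  so far. The query \<open>PUB h a b z0\<close> asks for a bound on \<open>{a..b}\<close> that is tight at
  \<open>z0\<close>.
\<close>

definition safe_rate ::
    "(real ^ 'n \<Rightarrow> real) \<Rightarrow> (real ^ 'n \<Rightarrow> (real ^ 'n) list \<Rightarrow> real ^ 'n) \<Rightarrow>
     ((real \<Rightarrow> real) \<Rightarrow> real \<Rightarrow> real \<Rightarrow> real \<Rightarrow> real poly) \<Rightarrow> nat \<Rightarrow> nat \<Rightarrow>
     (nat \<Rightarrow> real ^ 'n) \<Rightarrow> bool" where
  "safe_rate f Orc PUB k T x \<longleftrightarrow>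
     (\<exists>(g :: nat \<Rightarrow> real ^ 'n) (v :: nat \<Rightarrow> real ^ 'n) (h :: nat \<Rightarrow> real \<Rightarrow> real)
        (P :: nat \<Rightarrow> real poly) (\<eta> :: nat \<Rightarrow> real) (\<eta>bar :: nat \<Rightarrow> real).
        \<eta>bar 1 = 1 \<and>
        (\<forall>t\<in>{1..T}.
           GDERIV f (x t) :> g t \<and>
           v t = Orc (x t) (map g [1..<Suc t]) \<and>
           h t = (\<lambda>s. f (x t + s *\<^sub>R v t)) \<and>
           P t = PUB (h t) 0 (\<eta>bar t) 0 \<and>
           poly_upper_bound k (h t) 0 (\<eta>bar t) 0 (P t) \<and>
           is_arg_min (poly (P t)) (\<lambda>s. s \<in> {0..\<eta>bar t}) (\<eta> t) \<and>
           x (t + 1) = x t + \<eta> t *\<^sub>R v t \<and>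
           \<eta>bar (t + 1) =
             (if \<eta> t \<ge> \<eta>bar t / 2 then 2 * \<eta>bar t else \<eta>bar t / 2)))"

definition quad_form :: "real ^ 'd ^ 'd \<Rightarrow> real ^ 'd \<Rightarrow> real ^ 'd \<Rightarrow> real" where
  "quad_form A b y = (1/2) * (y \<bullet> (A *v y)) - b \<bullet> y"

definition quadratic_with :: "real ^ 'd ^ 'd \<Rightarrow> real ^ 'd \<Rightarrow> (real ^ 'd \<Rightarrow> real) \<Rightarrow> bool" where
  "quadratic_with A b P \<longleftrightarrow> transpose A = A \<and> (\<forall>y. P y = P 0 + quad_form A b y)"

definition quadratic_upper_bound ::
    "(real ^ 'd \<Rightarrow> real) \<Rightarrow> real ^ 'd \<Rightarrow> real ^ 'd \<Rightarrow> real ^ 'd \<Rightarrow> (real ^ 'd \<Rightarrow> real) \<Rightarrow> bool" where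
  "quadratic_upper_bound h a b z0 P \<longleftrightarrow>
     (\<exists>A c. quadratic_with A c P) \<and> (\<forall>z\<in>{a..b}. h z \<le> P z) \<and> P z0 = h z0"

text \<open>
  Stage 1. The index \<open>m\<close> is the number of steps taken before stopping. The line search
  minimizes \<open>q\<close> at the new point \<open>y (i - 1) + \<alpha> *\<^sub>R p i\<close>. Minimizing
  \<open>q (\<alpha> *\<^sub>R p i)\<close> instead amounts to the same as long as \<open>p i\<close> is
  \<open>A\<close>-conjugate to \<open>y (i - 1)\<close>, as in classical conjugate gradients. Once a step has
  been cut off at the boundary of the box, conjugacy is lost, and that rule can increase
  \<open>q\<close>, even above \<open>q 0\<close> after Stage 2. An example is
  \<open>A = [[7, -9], [-9, 5]]\<close>, \<open>b = (-1, -1)\<close> on \<open>[0, 1]^2\<close>, where the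
  result is \<open>(1/2, 7/10)\<close> with \<open>q = 3/20\<close>.
\<close>

definition cg_stage ::
    "real ^ 'd ^ 'd \<Rightarrow> real ^ 'd \<Rightarrow> (real ^ 'd) set \<Rightarrow> real ^ 'd \<Rightarrow> bool" where
  "cg_stage A b B z \<longleftrightarrow>
     (\<exists>(y :: nat \<Rightarrow> real ^ 'd) (r :: nat \<Rightarrow> real ^ 'd) (p :: nat \<Rightarrow> real ^ 'd)
        (\<alpha> :: nat \<Rightarrow> real) (m :: nat).
        y 0 = 0 \<and>
        (\<forall>i\<le>m. r i = A *v y i - b) \<and>
        m \<le> CARD('d) \<and> (\<forall>i<m. r i \<noteq> 0) \<and> (m = CARD('d) \<or> r m = 0) \<and>
        (\<forall>i\<in>{1..m}.
           p i = (if i = 1 then - r 0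
                  else - r (i - 1)
                       + ((r (i - 1) \<bullet> r (i - 1)) / (r (i - 2) \<bullet> r (i - 2))) *\<^sub>R p (i - 1)) \<and>
           is_arg_min (\<lambda>a. quad_form A b (y (i - 1) + a *\<^sub>R p i))
             (\<lambda>a. y (i - 1) + a *\<^sub>R p i \<in> B) (\<alpha> i) \<and>
           y i = y (i - 1) + \<alpha> i *\<^sub>R p i) \<and>
        z = y m)"

definition set_coord :: "real ^ 'd \<Rightarrow> 'd \<Rightarrow> real \<Rightarrow> real ^ 'd" where
  "set_coord z j c = (\<chi> i. if i = j then c else z $ i)"

fun coord_descent ::
    "(real ^ 'd \<Rightarrow> real) \<Rightarrow> (real ^ 'd) set \<Rightarrow> 'd list \<Rightarrow> real ^ 'd \<Rightarrow> real ^ 'd \<Rightarrow> bool" where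
  "coord_descent q B [] z w \<longleftrightarrow> w = z"
| "coord_descent q B (j # js) z w \<longleftrightarrow>
     (\<exists>c. is_arg_min (\<lambda>c. q (set_coord z j c)) (\<lambda>c. set_coord z j c \<in> B) c \<and>
          coord_descent q B js (set_coord z j c) w)"

text \<open>
  The linear order on the index type is the order in which Stage 2 visits the coordinates. Since
  \<open>A\<close> is required to be symmetric, \<open>A\<close> and \<open>b\<close> are determined by \<open>P\<close>.
\<close>

definition minimize_quadratic ::
    "(real ^ 'd::{finite,linorder} \<Rightarrow> real) \<Rightarrow> real ^ 'd::{finite,linorder} \<Rightarrow> real ^ 'd::{finite,linorder} \<Rightarrow> bool" where
  "minimize_quadratic P \<eta>bar w \<longleftrightarrow>
     (\<exists>A b z. quadratic_with A b P \<and>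
        cg_stage A b {0..\<eta>bar} z \<and>
        coord_descent (quad_form A b) {0..\<eta>bar} (sorted_list_of_set (UNIV :: 'd set)) z w)"

definition safe_combination ::
    "(real ^ 'n \<Rightarrow> real) \<Rightarrow>
     (real ^ 'n \<Rightarrow> (real ^ 'n) list \<Rightarrow> real ^ 'd::{finite,linorder} ^ 'n) \<Rightarrow>
     ((real ^ 'd::{finite,linorder} \<Rightarrow> real) \<Rightarrow> real ^ 'd::{finite,linorder} \<Rightarrow>
      real ^ 'd::{finite,linorder} \<Rightarrow> real ^ 'd::{finite,linorder} \<Rightarrow> (real ^ 'd::{finite,linorder} \<Rightarrow> real)) \<Rightarrow> nat \<Rightarrow>
     (nat \<Rightarrow> real ^ 'n) \<Rightarrow> bool" where
  "safe_combination f Orc PUB T x \<longleftrightarrow>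
     (\<exists>g U h P \<eta> \<eta>bar.
        \<eta>bar 1 = (\<chi> i. 1) \<and>
        (\<forall>t\<in>{1..T}.
           GDERIV f (x t) :> g t \<and>
           U t = Orc (x t) (map g [1..<Suc t]) \<and>
           h t = (\<lambda>s. f (x t + U t *v s)) \<and>
           P t = PUB (h t) 0 (\<eta>bar t) 0 \<and>
           quadratic_upper_bound (h t) 0 (\<eta>bar t) 0 (P t) \<and>
           minimize_quadratic (P t) (\<eta>bar t) (\<eta> t) \<and>
           x (t + 1) = x t + U t *v \<eta> t \<and>
           (\<forall>i. \<eta>bar (t + 1) $ i =
              (if \<eta> t $ i \<ge> \<eta>bar t $ i / 2 then 2 * \<eta>bar t $ i else \<eta>bar t $ i / 2))))"

end

theory Submission
  imports Defs
begin

text \<open>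
  In both algorithms the current point \<open>x t\<close> corresponds to the step \<open>0\<close>, where the upper
  bound \<open>P t\<close> is tight. The chosen step \<open>\<eta> t\<close> lies in the box and its \<open>P t\<close>-value is at most
  \<open>P t 0\<close>, so \<open>f (x (t + 1)) \<le> P t (\<eta> t) \<le> P t 0 = f (x t)\<close>. For MinimizeQuadratic the second
  inequality holds because every line search and every coordinate update can choose not to move.
  That \<open>0\<close> belongs to the box is read off from the step itself: a box \<open>{0..\<eta>bar t}\<close> that
  contains any point contains \<open>0\<close>.
\<close>

lemma is_arg_min_leD:
  fixes f :: "'a \<Rightarrow> 'b::linorder"
  assumes "is_arg_min f P x" and "P y"
  shows "f x \<le> f y"
  using assms by (auto simp: is_arg_min_linorder)

lemma set_coord_same [simp]: "set_coord z j (z $ j) = z"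
  by (simp add: set_coord_def vec_eq_iff)

text \<open>The hypothesis \<open>z \<in> B\<close> makes the old value \<open>z $ j\<close> an
  admissible competitor. Each minimizer is feasible itself, so the hypothesis carries over to the
  rest of the pass.\<close>

lemma coord_descent_decreases:
  assumes "coord_descent q B js z w" and "z \<in> B"
  shows "q w \<le> q z"
  using assms
proof (induction js arbitrary: z)
  case (Cons j js)
  then obtain c where c: "is_arg_min (\<lambda>c. q (set_coord z j c)) (\<lambda>c. set_coord z j c \<in> B) c"
    and w: "coord_descent q B js (set_coord z j c) w" by auto
  have "set_coord z j c \<in> B"
    using c by (simp add: is_arg_min_def)
  then have "q w \<le> q (set_coord z j c)"
    using Cons.IH w by blast
  also have "\<dots> \<le> q z"
    using is_arg_min_leD [OF c, of "z $ j"] Cons.prems by simp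
  finally show ?case .
qed simp

text \<open>Feasibility is imposed on the updated point, so the last update alone puts
  \<open>w\<close> in \<open>B\<close>, wherever the pass started.\<close>

lemma coord_descent_mem:
  assumes "coord_descent q B js z w" and "js \<noteq> []"
  shows "w \<in> B"
  using assms
proof (induction js arbitrary: z)
  case (Cons j js)
  then show ?case
    by (cases "js = []") (auto simp: is_arg_min_def)
qed simp

text \<open>Both claims form one invariant: feasibility of the current point admits step length 0 in
  the next line search, whose minimizer is feasible in turn.\<close>

lemma cg_stage_decreases:
  assumes "cg_stage A b B z" and "0 \<in> B"
  shows "z \<in> B \<and> quad_form A b z \<le> quad_form A b 0"
  using assms(1) unfolding cg_stage_def
proof (elim exE conjE, goal_cases)
  case (1 y r p \<alpha> m)
  have step: "is_arg_min (\<lambda>a. quad_form A b (y (i - 1) + a *\<^sub>R p i))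
        (\<lambda>a. y (i - 1) + a *\<^sub>R p i \<in> B) (\<alpha> i) \<and>
      y i = y (i - 1) + \<alpha> i *\<^sub>R p i" if "i \<in> {1..m}" for i
    using bspec [OF 1(6) that] by (elim conjE) (intro conjI)
  have "y i \<in> B \<and> quad_form A b (y i) \<le> quad_form A b 0" if "i \<le> m" for i
    using that
  proof (induction i)
    case 0
    show ?case using 1(1) assms(2) by simp
  next
    case (Suc i)
    have arg: "is_arg_min (\<lambda>a. quad_form A b (y i + a *\<^sub>R p (Suc i)))
        (\<lambda>a. y i + a *\<^sub>R p (Suc i) \<in> B) (\<alpha> (Suc i))"
      and ySuc: "y (Suc i) = y i + \<alpha> (Suc i) *\<^sub>R p (Suc i)"
      using step [of "Suc i"] Suc.prems by auto
    have "y (Suc i) \<in> B"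
      using arg ySuc by (simp add: is_arg_min_def)
    moreover have "quad_form A b (y (Suc i)) \<le> quad_form A b (y i)"
      using is_arg_min_leD [OF arg, of 0] Suc ySuc by simp
    ultimately show ?case using Suc by simp
  qed
  then show ?thesis using \<open>z = y m\<close> by simp
qed

lemma minimize_quadratic_decreases:
  assumes "minimize_quadratic P u w"
  shows "w \<in> {0..u} \<and> P w \<le> P 0"
proof -
  obtain A b z where P: "quadratic_with A b P"
    and cg: "cg_stage A b {0..u} z"
    and cd: "coord_descent (quad_form A b) {0..u} (sorted_list_of_set UNIV) z w"
    using assms unfolding minimize_quadratic_def by blast
  \<comment> \<open>The list of coordinates is nonempty because an index type has an
    element.\<close>
  have w: "w \<in> {0..u}"
    using coord_descent_mem [OF cd] by simp
  then have zero: "0 \<in> {0..u}"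
    using order_trans [of 0 w u] by simp
  \<comment> \<open>Stage 1 also yields \<open>z \<in> {0..u}\<close>, the premise for Stage
    2.\<close>
  have "quad_form A b w \<le> quad_form A b 0"
    using cg_stage_decreases [OF cg zero] coord_descent_decreases [OF cd] by fastforce
  moreover have "quad_form A b 0 = 0"
    by (simp add: quad_form_def)
  moreover have "P w = P 0 + quad_form A b w"
    using P unfolding quadratic_with_def by blast
  ultimately have "P w \<le> P 0"
    by linarith
  with w show ?thesis by simp
qed

theorem proposition1:
  fixes f :: "real ^ 'n \<Rightarrow> real"
    and x :: "nat \<Rightarrow> real ^ 'n"
    and T k :: nat
    and Orc_rate :: "real ^ 'n \<Rightarrow> (real ^ 'n) list \<Rightarrow> real ^ 'n"
    and PUB_rate :: "(real \<Rightarrow> real) \<Rightarrow> real \<Rightarrow> real \<Rightarrow> real \<Rightarrow> real poly"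
    and Orc_comb :: "real ^ 'n \<Rightarrow> (real ^ 'n) list \<Rightarrow> real ^ 'd::{finite,linorder} ^ 'n"
    and PUB_comb ::
      "(real ^ 'd::{finite,linorder} \<Rightarrow> real) \<Rightarrow> real ^ 'd::{finite,linorder} \<Rightarrow>
       real ^ 'd::{finite,linorder} \<Rightarrow> real ^ 'd::{finite,linorder} \<Rightarrow>
       (real ^ 'd::{finite,linorder} \<Rightarrow> real)"
  assumes "\<And>z. f differentiable (at z)"
    and "T \<ge> 1"
    and "safe_rate f Orc_rate PUB_rate k T x \<or> safe_combination f Orc_comb PUB_comb T x"
  shows "\<forall>t\<in>{1..T}. f (x (t + 1)) \<le> f (x t)"
  using assms(3)
proof
  assume "safe_rate f Orc_rate PUB_rate k T x"
  then obtain v h P \<eta> u where step: "\<And>t. t \<in> {1..T} \<Longrightarrow>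
      h t = (\<lambda>s. f (x t + s *\<^sub>R v t)) \<and>
      poly_upper_bound k (h t) 0 (u t) 0 (P t) \<and>
      is_arg_min (poly (P t)) (\<lambda>s. s \<in> {0..u t}) (\<eta> t) \<and>
      x (t + 1) = x t + \<eta> t *\<^sub>R v t"
    unfolding safe_rate_def
    by (elim exE conjE) (rule that, drule (1) bspec, elim conjE, intro conjI; assumption)
  show ?thesis
  proof
    fix t assume "t \<in> {1..T}"
    note s = step [OF this]
    then have mem: "\<eta> t \<in> {0..u t}"
      by (simp add: is_arg_min_def)
    \<comment> \<open>The update rule makes the left side \<open>h t (\<eta> t)\<close>; the bound
      holds only on the interval, hence \<open>mem\<close>.\<close>
    then have "f (x (t + 1)) \<le> poly (P t) (\<eta> t)"
      using s by (auto simp: poly_upper_bound_def)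
    also have "\<dots> \<le> poly (P t) 0"
      using s mem by (intro is_arg_min_leD [where P = "\<lambda>s. s \<in> {0..u t}"]) auto
    also have "\<dots> = f (x t)"
      using s by (auto simp: poly_upper_bound_def)
    finally show "f (x (t + 1)) \<le> f (x t)" .
  qed
next
  assume "safe_combination f Orc_comb PUB_comb T x"
  then obtain U :: "nat \<Rightarrow> real ^ 'd::{finite,linorder} ^ 'n" and h P \<eta> u where
    step: "\<And>t. t \<in> {1..T} \<Longrightarrow>
      h t = (\<lambda>s. f (x t + U t *v s)) \<and>
      quadratic_upper_bound (h t) 0 (u t) 0 (P t) \<and>
      minimize_quadratic (P t) (u t) (\<eta> t) \<and>
      x (t + 1) = x t + U t *v \<eta> t"
    unfolding safe_combination_def
    by (elim exE conjE) (rule that, drule (1) bspec, elim conjE, intro conjI; assumption)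
  show ?thesis
  proof
    fix t assume "t \<in> {1..T}"
    note s = step [OF this]
    \<comment> \<open>Here \<open>\<eta> t\<close> need not minimize \<open>P t\<close> over the
      box; comparison with the starting point \<open>0\<close> takes the place of
      minimality.\<close>
    then have min: "\<eta> t \<in> {0..u t} \<and> P t (\<eta> t) \<le> P t 0"
      using minimize_quadratic_decreases by blast
    then have "f (x (t + 1)) \<le> P t (\<eta> t)"
      using s by (auto simp: quadratic_upper_bound_def)
    also have "\<dots> \<le> P t 0"
      using min by simp
    also have "\<dots> = f (x t)"
      using s by (auto simp: quadratic_upper_bound_def)
    finally show "f (x (t + 1)) \<le> f (x t)" .
  qed
qed

end
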